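(* Let $T$ be a $\lambda C$-term such that $\vdash_{M2}T:\forall X_C\{\neg\neg X_C\rightarrow X_C\}$, where $X_C$ is a classical variable of arity $0$. Then there is an integer $m$ such that for every integer $n$ and all $\lambda C$-terms $t,t_1,\dots,t_n$, there are $\lambda C$-terms $V_1,\dots,V_m$ and new variables $y_1,\dots,y_m$ with $(T)t\,t_1\dots t_n\succ_C(t)V_1$, $(V_i)y_i\succ_C(t)V_{i+1}$ for $1\leq i\leq m-1$, and $(V_m)y_m\succ_C(y_i)t_1\dots t_n$ for some $1\leq i\leq m$.
   Context: $\lambda C$-terms are terms of the pure $\lambda$-calculus extended with a constant $C$; $(t)u_1\dots u_n$ denotes iterated application. $\succ_C$ is the reflexive–transitive closure of $(\lambda xu)t\,t_1\dots t_n\to(u[t/x])t_1\dots t_n$ and $(C)t\,t_1\dots t_n\to(t)\lambda x(x)t_1\dots t_n$ ($x$ fresh). System $M2$: types are second-order formulas built from $\perp$ and atomic formulas using $\rightarrow,\forall x,\forall X$ (first-order terms, equations $u=v:=\forall Y(Y(u)\rightarrow Y(v))$, a fixed set of equations with $a\approx b$ meaning $a=b$ follows from it); $\neg A=A\rightarrow\perp$. Besides ordinary predicate variables there are classical predicate variables $X_C$. A type ends with $X$ if it is $X(\vec t)$, or $A\rightarrow B$ with $B$ ending with $X$, or $\forall vA$ with $A$ ending with $X$; a classical type ends with $\perp$ or a classical variable. Rules: axiom; $\rightarrow$-intro/elim; $\forall x$-intro ($x$ not free in context)/elim (any term); $\forall X$-intro/elim (any formula) for ordinary $X$; equational rule (from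 $t:A[u/x]$ and $u\approx v$ get $t:A[v/x]$); $\Gamma\vdash C:\forall X_C\{\neg\neg X_C\rightarrow X_C\}$; $\forall X_C$-intro ($X_C$ not free in context); $\forall X_C$-elim instantiating only by classical types. *)

theory Defs
  imports Main
begin

section \<open>Terms of the lambda calculus with the constant C\<close>

text \<open>De Bruijn representation: the variable \<open>Var i\<close> below \<open>d\<close> binders is bound if \<open>i < d\<close>
  and otherwise denotes the free variable number \<open>i - d\<close>.\<close>

datatype lcterm =
    Var nat
  | App lcterm lcterm
  | Lam lcterm
  | ConstC

primrec ren :: "(nat \<Rightarrow> nat) \<Rightarrow> lcterm \<Rightarrow> lcterm" where
  "ren r (Var i) = Var (r i)"
| "ren r (App t u) = App (ren r t) (ren r u)"
| "ren r (Lam t) = Lam (ren (case_nat 0 (\<lambda>i. Suc (r i))) t)"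
| "ren r ConstC = ConstC"

primrec sub :: "(nat \<Rightarrow> lcterm) \<Rightarrow> lcterm \<Rightarrow> lcterm" where
  "sub s (Var i) = s i"
| "sub s (App t u) = App (sub s t) (sub s u)"
| "sub s (Lam t) = Lam (sub (case_nat (Var 0) (\<lambda>i. ren Suc (s i))) t)"
| "sub s ConstC = ConstC"

primrec fv :: "lcterm \<Rightarrow> nat set" where
  "fv (Var i) = {i}"
| "fv (App t u) = fv t \<union> fv u"
| "fv (Lam t) = {i. Suc i \<in> fv t}"
| "fv ConstC = {}"

definition apps :: "lcterm \<Rightarrow> lcterm list \<Rightarrow> lcterm" where
  "apps t us = foldl App t us"

text \<open>In \<open>step_C\<close> the arguments go below the new binder, hence \<open>ren Suc\<close>.\<close>

inductive head_step :: "lcterm \<Rightarrow> lcterm \<Rightarrow> bool" where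
  step_beta: "head_step (apps (Lam u) (t # ts)) (apps (sub (case_nat t Var) u) ts)"
| step_C: "head_step (apps ConstC (t # ts)) (App t (Lam (apps (Var 0) (map (ren Suc) ts))))"

abbreviation head_red :: "lcterm \<Rightarrow> lcterm \<Rightarrow> bool" (infix "\<succ>\<^sub>C" 50) where
  "t \<succ>\<^sub>C u \<equiv> head_step\<^sup>*\<^sup>* t u"

section \<open>Second-order types\<close>

text \<open>A symbol of the language is a name together with an arity.\<close>

datatype ('f, 'p) language =
  Language (fun_syms: "('f \<times> nat) set") (pred_syms: "('p \<times> nat) set")

datatype 'f trm = TVar nat | TFun 'f "'f trm list"

primrec tsub :: "(nat \<Rightarrow> 'f trm) \<Rightarrow> 'f trm \<Rightarrow> 'f trm" where
  "tsub s (TVar i) = s i"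
| "tsub s (TFun f ts) = TFun f (map (tsub s) ts)"

fun wf_trm :: "('f, 'p) language \<Rightarrow> 'f trm \<Rightarrow> bool" where
  "wf_trm L (TVar i) = True"
| "wf_trm L (TFun f ts) = ((f, length ts) \<in> fun_syms L \<and> (\<forall>t \<in> set ts. wf_trm L t))"

text \<open>The consequence relation of a set of equations, by equational logic. As usual the variables
  of the given equations stand for arbitrary terms.\<close>

inductive eq_conseq ::
  "('f, 'p) language \<Rightarrow> ('f trm \<times> 'f trm) set \<Rightarrow> 'f trm \<Rightarrow> 'f trm \<Rightarrow> bool"
  for L E where
  eq_ax: "\<lbrakk>(a, b) \<in> E; \<And>i. wf_trm L (s i)\<rbrakk> \<Longrightarrow> eq_conseq L E (tsub s a) (tsub s b)"
| eq_refl: "wf_trm L a \<Longrightarrow> eq_conseq L E a a"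
| eq_sym: "eq_conseq L E a b \<Longrightarrow> eq_conseq L E b a"
| eq_trans: "\<lbrakk>eq_conseq L E a b; eq_conseq L E b c\<rbrakk> \<Longrightarrow> eq_conseq L E a c"
| eq_cong: "\<lbrakk>(f, length as) \<in> fun_syms L; list_all2 (eq_conseq L E) as bs\<rbrakk>
    \<Longrightarrow> eq_conseq L E (TFun f as) (TFun f bs)"

datatype kind = Ordinary | Classical

datatype 'p pred = PSym 'p | PVar kind nat

text \<open>There is one de Bruijn numbering for first-order variables, and one for the predicate
  variables of each kind and each arity. The arity of the predicate variable in an atom is the length
  of the argument list; \<open>All2 c k\<close> binds variable \<open>0\<close> of kind \<open>c\<close> and arity \<open>k\<close>.\<close>

datatype ('f, 'p) fml =
    Bot
  | Atom "'p pred" "'f trm list"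
  | Imp "('f, 'p) fml" "('f, 'p) fml"  (infixr "\<rightarrow>\<^sub>F" 60)
  | All1 "('f, 'p) fml"
  | All2 kind nat "('f, 'p) fml"

abbreviation Neg :: "('f, 'p) fml \<Rightarrow> ('f, 'p) fml" where
  "Neg A \<equiv> A \<rightarrow>\<^sub>F Bot"

primrec wf_fml :: "('f, 'p) language \<Rightarrow> ('f, 'p) fml \<Rightarrow> bool" where
  "wf_fml L Bot = True"
| "wf_fml L (Atom p ts) =
    ((\<forall>q. p = PSym q \<longrightarrow> (q, length ts) \<in> pred_syms L) \<and> (\<forall>t \<in> set ts. wf_trm L t))"
| "wf_fml L (A \<rightarrow>\<^sub>F B) = (wf_fml L A \<and> wf_fml L B)"
| "wf_fml L (All1 A) = wf_fml L A"
| "wf_fml L (All2 c k A) = wf_fml L A"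

primrec fsub :: "(nat \<Rightarrow> 'f trm) \<Rightarrow> ('f, 'p) fml \<Rightarrow> ('f, 'p) fml" where
  "fsub s Bot = Bot"
| "fsub s (Atom p ts) = Atom p (map (tsub s) ts)"
| "fsub s (A \<rightarrow>\<^sub>F B) = fsub s A \<rightarrow>\<^sub>F fsub s B"
| "fsub s (All1 A) =
    All1 (fsub (case_nat (TVar 0) (\<lambda>i. tsub (\<lambda>j. TVar (Suc j)) (s i))) A)"
| "fsub s (All2 c k A) = All2 c k (fsub s A)"

abbreviation inst1 :: "'f trm \<Rightarrow> ('f, 'p) fml \<Rightarrow> ('f, 'p) fml" where
  "inst1 u A \<equiv> fsub (case_nat u TVar) A"

abbreviation lift1 :: "('f, 'p) fml \<Rightarrow> ('f, 'p) fml" where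
  "lift1 A \<equiv> fsub (\<lambda>i. TVar (Suc i)) A"

text \<open>\<open>lift2 c k d A\<close> renames the predicate variables of kind \<open>c\<close> and arity \<open>k\<close> so that variable
  \<open>d\<close> does not occur.\<close>

primrec lift2 :: "kind \<Rightarrow> nat \<Rightarrow> nat \<Rightarrow> ('f, 'p) fml \<Rightarrow> ('f, 'p) fml" where
  "lift2 c k d Bot = Bot"
| "lift2 c k d (Atom p ts) =
    (case p of
       PSym q \<Rightarrow> Atom p ts
     | PVar c' i \<Rightarrow>
         if c' = c \<and> length ts = k \<and> d \<le> i then Atom (PVar c' (Suc i)) ts else Atom p ts)"
| "lift2 c k d (A \<rightarrow>\<^sub>F B) = lift2 c k d A \<rightarrow>\<^sub>F lift2 c k d B"
| "lift2 c k d (All1 A) = All1 (lift2 c k d A)"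
| "lift2 c k d (All2 c' k' A) =
    All2 c' k' (lift2 c k (if c' = c \<and> k' = k then Suc d else d) A)"

text \<open>\<open>sub2 c k d G A\<close> is $A[G/X(x_1,\dots,x_k)]$ where \<open>X\<close> is variable \<open>d\<close> of kind \<open>c\<close> and arity \<open>k\<close>;
  the later variables of this kind and arity are renumbered. In \<open>G\<close> the variables \<open>0, \<dots>, k - 1\<close>
  are the parameters $x_1,\dots,x_k$, and \<open>k + i\<close> is the first-order variable that is \<open>i\<close>
  in \<open>A\<close>.\<close>

primrec sub2 ::
  "kind \<Rightarrow> nat \<Rightarrow> nat \<Rightarrow> ('f, 'p) fml \<Rightarrow> ('f, 'p) fml \<Rightarrow> ('f, 'p) fml" where
  "sub2 c k d G Bot = Bot"
| "sub2 c k d G (Atom p ts) =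
    (case p of
       PSym q \<Rightarrow> Atom p ts
     | PVar c' i \<Rightarrow>
         if c' = c \<and> length ts = k then
           (if i = d then fsub (\<lambda>j. if j < k then ts ! j else TVar (j - k)) G
            else Atom (PVar c' (if d < i then i - 1 else i)) ts)
         else Atom p ts)"
| "sub2 c k d G (A \<rightarrow>\<^sub>F B) = sub2 c k d G A \<rightarrow>\<^sub>F sub2 c k d G B"
| "sub2 c k d G (All1 A) =
    All1 (sub2 c k d (fsub (\<lambda>j. if j < k then TVar j else TVar (Suc j)) G) A)"
| "sub2 c k d G (All2 c' k' A) =
    All2 c' k' (sub2 c k (if c' = c \<and> k' = k then Suc d else d) (lift2 c' k' 0 G) A)"

text \<open>The predicate a type ends with, \<open>None\<close> standing for \<open>Bot\<close>. It may be bound in the type, and its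
  index is counted at its occurrence.\<close>

primrec ending :: "('f, 'p) fml \<Rightarrow> 'p pred option" where
  "ending Bot = None"
| "ending (Atom p ts) = Some p"
| "ending (A \<rightarrow>\<^sub>F B) = ending B"
| "ending (All1 A) = ending A"
| "ending (All2 c k A) = ending A"

definition classical_type :: "('f, 'p) fml \<Rightarrow> bool" where
  "classical_type A \<longleftrightarrow> ending A = None \<or> (\<exists>i. ending A = Some (PVar Classical i))"

definition dne :: "('f, 'p) fml" where
  "dne = All2 Classical 0
     (Neg (Neg (Atom (PVar Classical 0) [])) \<rightarrow>\<^sub>F Atom (PVar Classical 0) [])"

section \<open>The type system M2\<close>

text \<open>A context lists the types of the variables \<open>Var 0, Var 1, \<dots>\<close>. The condition that the variable
  quantified by an introduction rule is not free in the context is expressed by lifting the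
  context.\<close>

inductive M2 ::
  "('f, 'p) language \<Rightarrow> ('f trm \<times> 'f trm) set \<Rightarrow>
   ('f, 'p) fml list \<Rightarrow> lcterm \<Rightarrow> ('f, 'p) fml \<Rightarrow> bool"
  for L E where
  M2_ax: "\<lbrakk>\<forall>A \<in> set \<Gamma>. wf_fml L A; i < length \<Gamma>\<rbrakk> \<Longrightarrow> M2 L E \<Gamma> (Var i) (\<Gamma> ! i)"
| M2_imp_intro: "M2 L E (A # \<Gamma>) t B \<Longrightarrow> M2 L E \<Gamma> (Lam t) (A \<rightarrow>\<^sub>F B)"
| M2_imp_elim: "\<lbrakk>M2 L E \<Gamma> t (A \<rightarrow>\<^sub>F B); M2 L E \<Gamma> u A\<rbrakk> \<Longrightarrow> M2 L E \<Gamma> (App t u) B"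
| M2_all1_intro: "M2 L E (map lift1 \<Gamma>) t A \<Longrightarrow> M2 L E \<Gamma> t (All1 A)"
| M2_all1_elim: "\<lbrakk>M2 L E \<Gamma> t (All1 A); wf_trm L u\<rbrakk> \<Longrightarrow> M2 L E \<Gamma> t (inst1 u A)"
| M2_all2_intro: "M2 L E (map (lift2 Ordinary k 0) \<Gamma>) t A \<Longrightarrow> M2 L E \<Gamma> t (All2 Ordinary k A)"
| M2_all2_elim: "\<lbrakk>M2 L E \<Gamma> t (All2 Ordinary k A); wf_fml L G\<rbrakk>
    \<Longrightarrow> M2 L E \<Gamma> t (sub2 Ordinary k 0 G A)"
| M2_eq: "\<lbrakk>M2 L E \<Gamma> t (inst1 u A); eq_conseq L E u v\<rbrakk> \<Longrightarrow> M2 L E \<Gamma> t (inst1 v A)"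
| M2_C: "\<forall>A \<in> set \<Gamma>. wf_fml L A \<Longrightarrow> M2 L E \<Gamma> ConstC dne"
| M2_allC_intro: "M2 L E (map (lift2 Classical k 0) \<Gamma>) t A \<Longrightarrow> M2 L E \<Gamma> t (All2 Classical k A)"
| M2_allC_elim: "\<lbrakk>M2 L E \<Gamma> t (All2 Classical k A); wf_fml L G; classical_type G\<rbrakk>
    \<Longrightarrow> M2 L E \<Gamma> t (sub2 Classical k 0 G A)"

end

theory Submission
  imports Defs
begin

text \<open>The proof is a reducibility argument with a pole, after Krivine. To obtain an \<open>m\<close> that does
  not depend on \<open>t, t\<^sub>1, \<dots>, t\<^sub>n\<close>, types are interpreted by sets of families of terms indexed by
  all pairs \<open>(t, [t\<^sub>1, \<dots>, t\<^sub>n])\<close>, and application and reduction are pointwise. Absurdity is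
  interpreted by the families that win, in a number of rounds uniform in the index, the game in which
  the term must reduce to \<open>(t)V\<close>, after which \<open>(V)y\<close> is played with any fresh \<open>y\<close>, until it
  reduces to \<open>(y)t\<^sub>1\<dots>t\<^sub>n\<close> for one of these \<open>y\<close>. If \<open>X\<^sub>C\<close> is interpreted by the single stack
  \<open>t\<^sub>1, \<dots>, t\<^sub>n\<close>, then every fresh \<open>y\<close> realizes \<open>X\<^sub>C\<close> and \<open>t\<close> realizes \<open>\<not>\<not>X\<^sub>C\<close>, so
  \<open>(T)t t\<^sub>1\<dots>t\<^sub>n\<close> wins.\<close>

section \<open>Substitution and free variables\<close>

lemma sub_Var [simp]: "sub Var t = t"
proof -
  have "case_nat (Var 0) (\<lambda>i. Var (Suc i)) = Var"
    by (auto simp: fun_eq_iff split: nat.split)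
  then show ?thesis
    by (induction t) auto
qed

lemma sub_ren: "sub s (ren r t) = sub (\<lambda>i. s (r i)) t"
proof (induction t arbitrary: s r)
  case (Lam t)
  have "(\<lambda>i. case_nat (Var 0) (\<lambda>i. ren Suc (s i)) (case_nat 0 (\<lambda>i. Suc (r i)) i))
    = case_nat (Var 0) (\<lambda>i. ren Suc (s (r i)))"
    by (auto simp: fun_eq_iff split: nat.split)
  then show ?case
    using Lam by simp
qed auto

lemma ren_ren: "ren s (ren r t) = ren (\<lambda>i. s (r i)) t"
proof (induction t arbitrary: s r)
  case (Lam t)
  have "(\<lambda>i. case_nat 0 (\<lambda>i. Suc (s i)) (case_nat 0 (\<lambda>i. Suc (r i)) i))
    = case_nat 0 (\<lambda>i. Suc (s (r i)))"
    by (auto simp: fun_eq_iff split: nat.split)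
  then show ?case
    using Lam by simp
qed auto

lemma ren_sub: "ren r (sub s t) = sub (\<lambda>i. ren r (s i)) t"
proof (induction t arbitrary: s r)
  case (Lam t)
  have "(\<lambda>i. ren (case_nat 0 (\<lambda>i. Suc (r i))) (case_nat (Var 0) (\<lambda>i. ren Suc (s i)) i))
    = case_nat (Var 0) (\<lambda>i. ren Suc (ren r (s i)))"
    by (auto simp: fun_eq_iff ren_ren split: nat.split)
  then show ?case
    using Lam by simp
qed auto

lemma sub_sub: "sub s (sub r t) = sub (\<lambda>i. sub s (r i)) t"
proof (induction t arbitrary: s r)
  case (Lam t)
  have "(\<lambda>i. sub (case_nat (Var 0) (\<lambda>i. ren Suc (s i))) (case_nat (Var 0) (\<lambda>i. ren Suc (r i)) i))
    = case_nat (Var 0) (\<lambda>i. ren Suc (sub s (r i)))"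
    by (auto simp: fun_eq_iff sub_ren ren_sub split: nat.split)
  then show ?case
    using Lam by simp
qed auto

text \<open>Substituting \<open>u\<close> undoes the shift \<open>ren Suc\<close>, so contracting a
  substituted abstraction just extends the substitution; the arrow introduction case of
  \<open>adequacy\<close> rests on this.\<close>

lemma sub_beta:
  "sub (case_nat u Var) (sub (case_nat (Var 0) (\<lambda>i. ren Suc (s i))) t) = sub (case_nat u s) t"
proof -
  have "(\<lambda>i. sub (case_nat u Var) (case_nat (Var 0) (\<lambda>i. ren Suc (s i)) i)) = case_nat u s"
    by (auto simp: fun_eq_iff sub_ren split: nat.split)
  then show ?thesis
    by (simp add: sub_sub)
qed

lemma fv_ren: "fv (ren r t) = r ` fv t"
proof (induction t arbitrary: r)
  case (Lam t)
  have "Suc i = case_nat 0 (\<lambda>i. Suc (r i)) x \<longleftrightarrow> (\<exists>z. x = Suc z \<and> i = r z)" for i x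
    by (cases x) auto
  then show ?case
    by (auto simp: Lam image_iff)
qed auto

lemma fv_sub: "fv (sub s t) = (\<Union>x\<in>fv t. fv (s x))"
proof (induction t arbitrary: s)
  case (Lam t)
  have "Suc i \<in> fv (case_nat (Var 0) (\<lambda>i. ren Suc (s i)) x) \<longleftrightarrow> (\<exists>z. x = Suc z \<and> i \<in> fv (s z))"
    for i x by (cases x) (auto simp: fv_ren)
  then show ?case
    by (auto simp: Lam)
qed auto

lemma finite_fv: "finite (fv t)"
proof (induction t)
  case (Lam t)
  have "fv (Lam t) = Suc -` fv t"
    by auto
  then show ?case
    using Lam by (simp add: finite_vimageI)
qed auto

lemma apps_Nil [simp]: "apps t [] = t"
  and apps_Cons [simp]: "apps t (u # us) = apps (App t u) us"
  by (simp_all add: apps_def)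

lemma fv_apps: "fv (apps t us) = fv t \<union> \<Union> (fv ` set us)"
  by (induction us arbitrary: t) auto

lemma head_step_fv: "head_step t u \<Longrightarrow> fv u \<subseteq> fv t"
proof (induction rule: head_step.induct)
  case (step_beta u t ts)
  have "fv (sub (case_nat t Var) u) \<subseteq> fv (Lam u) \<union> fv t"
    by (auto simp: fv_sub split: nat.splits)
  then show ?case
    by (auto simp: fv_apps)
next
  case (step_C t ts)
  show ?case
    by (auto simp: fv_apps fv_ren)
qed

lemma head_red_fv: "t \<succ>\<^sub>C u \<Longrightarrow> fv u \<subseteq> fv t"
  by (induction rule: rtranclp_induct) (auto dest: head_step_fv)

section \<open>Interpretation of types\<close>

text \<open>A contraction of \<open>C\<close> is not preserved by applying the term to one more argument, so that
  arbitrary types are only closed under head expansion without \<open>C\<close>.\<close>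

definition beta_closed :: "('i \<Rightarrow> lcterm) set \<Rightarrow> bool" where
  "beta_closed S \<longleftrightarrow> (\<forall>u t ts. (\<lambda>i. apps (sub (case_nat (t i) Var) (u i)) (ts i)) \<in> S
     \<longrightarrow> (\<lambda>i. apps (Lam (u i)) (t i # ts i)) \<in> S)"

lemma beta_closedD:
  assumes "beta_closed S" "(\<lambda>i. apps (sub (case_nat (t i) Var) (u i)) (ts i)) \<in> S"
  shows "(\<lambda>i. apps (Lam (u i)) (t i # ts i)) \<in> S"
  using assms unfolding beta_closed_def by blast

lemma App_apps: "App (apps t us) v = apps t (us @ [v])"
  by (simp add: apps_def)

lemma apps_append: "apps (apps t us) vs = apps t (us @ vs)"
  by (simp add: apps_def)

text \<open>Semantic side of the renumbering done by \<open>lift2\<close> and \<open>sub2\<close>: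
  entries from \<open>d\<close> on, for this kind and arity only, move up by one.\<close>

definition ins :: "(kind \<Rightarrow> nat \<Rightarrow> nat \<Rightarrow> 'a) \<Rightarrow> kind \<Rightarrow> nat \<Rightarrow> nat \<Rightarrow> 'a \<Rightarrow> kind \<Rightarrow> nat \<Rightarrow> nat \<Rightarrow> 'a" where
  "ins \<rho> c k d S = (\<lambda>c' k' i. if c' = c \<and> k' = k
     then (if i < d then \<rho> c k i else if i = d then S else \<rho> c k (i - 1)) else \<rho> c' k' i)"

lemma ins_swap:
  "ins (ins \<rho> c k d S) c' k' 0 S'
    = ins (ins \<rho> c' k' 0 S') c k (if c' = c \<and> k' = k then Suc d else d) S"
  by (auto simp: ins_def fun_eq_iff)

locale pole =
  fixes bot :: "('i \<Rightarrow> lcterm) set"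
  assumes expand: "G \<in> bot \<Longrightarrow> (\<And>i. head_step (F i) (G i)) \<Longrightarrow> F \<in> bot"
begin

definition orth :: "('i \<Rightarrow> lcterm list) set \<Rightarrow> ('i \<Rightarrow> lcterm) set" where
  "orth \<Phi> = {F. \<forall>\<Pi>\<in>\<Phi>. (\<lambda>i. apps (F i) (\<Pi> i)) \<in> bot}"

text \<open>Classical variables range only over orthogonals: C captures a stack, so membership has
  to be tested by stacks for C to realize \<open>dne\<close>.\<close>

primrec adm :: "kind \<Rightarrow> ('i \<Rightarrow> lcterm) set set" where
  "adm Ordinary = {S. beta_closed S}"
| "adm Classical = range orth"

text \<open>The first-order domain has one element, so all equations hold and terms are ignored.\<close>

primrec interp ::
  "(kind \<Rightarrow> nat \<Rightarrow> nat \<Rightarrow> ('i \<Rightarrow> lcterm) set) \<Rightarrow> ('f, 'p) fml \<Rightarrow> ('i \<Rightarrow> lcterm) set" where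
  "interp \<rho> Bot = bot"
| "interp \<rho> (Atom p ts) = (case p of PSym q \<Rightarrow> UNIV | PVar c i \<Rightarrow> \<rho> c (length ts) i)"
| "interp \<rho> (A \<rightarrow>\<^sub>F B) = {F. \<forall>G\<in>interp \<rho> A. (\<lambda>i. App (F i) (G i)) \<in> interp \<rho> B}"
| "interp \<rho> (All1 A) = interp \<rho> A"
| "interp \<rho> (All2 c k A) = (\<Inter>S\<in>adm c. interp (ins \<rho> c k 0 S) A)"

lemma interp_fsub [simp]: "interp \<rho> (fsub s A) = interp \<rho> A"
  by (induction A arbitrary: \<rho> s) (auto split: pred.split)

lemma interp_lift2: "interp (ins \<rho> c k d S) (lift2 c k d A) = interp \<rho> A"
proof (induction A arbitrary: \<rho> d)
  case (Atom p ts)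
  show ?case
    by (cases p) (auto simp: ins_def)
next
  case (All2 c' k' A)
  show ?case
    by (simp add: ins_swap All2)
qed auto

text \<open>Under a second-order binder \<open>G\<close> is lifted; \<open>interp_lift2\<close>
  cancels the lifting and \<open>ins_swap\<close> exchanges the two insertions.\<close>

lemma interp_sub2:
  "interp \<rho> (sub2 c k d G A) = interp (ins \<rho> c k d (interp \<rho> G)) A"
proof (induction A arbitrary: \<rho> d G)
  case (Atom p ts)
  show ?case
    by (cases p) (auto simp: ins_def)
next
  case (All2 c' k' A)
  show ?case
    by (simp add: ins_swap All2 interp_lift2)
qed auto

section \<open>Closure properties of interpreted types\<close>

lemma beta_closed_orth: "beta_closed (orth \<Phi>)"
  unfolding beta_closed_def
proof (intro allI impI)
  fix u t ts
  assume *: "(\<lambda>i. apps (sub (case_nat (t i) Var) (u i)) (ts i)) \<in> orth \<Phi>"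
  have "(\<lambda>i. apps (apps (Lam (u i)) (t i # ts i)) (\<Pi> i)) \<in> bot" if "\<Pi> \<in> \<Phi>" for \<Pi>
  proof (rule expand)
    show "(\<lambda>i. apps (sub (case_nat (t i) Var) (u i)) (ts i @ \<Pi> i)) \<in> bot"
      using * that by (simp add: orth_def apps_append)
    show "head_step (apps (apps (Lam (u i)) (t i # ts i)) (\<Pi> i))
        (apps (sub (case_nat (t i) Var) (u i)) (ts i @ \<Pi> i))" for i
      using step_beta[of "u i" "t i" "ts i @ \<Pi> i"] by (simp add: apps_append)
  qed
  then show "(\<lambda>i. apps (Lam (u i)) (t i # ts i)) \<in> orth \<Phi>"
    by (simp add: orth_def)
qed

lemma bot_orth: "bot \<in> range orth"
proof
  show "bot = orth {\<lambda>i. []}"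
    by (simp add: orth_def)
qed simp

lemma beta_closed_adm: "S \<in> adm c \<Longrightarrow> beta_closed S"
  by (cases c) (auto simp: beta_closed_orth)

definition admissible :: "(kind \<Rightarrow> nat \<Rightarrow> nat \<Rightarrow> ('i \<Rightarrow> lcterm) set) \<Rightarrow> bool" where
  "admissible \<rho> \<longleftrightarrow> (\<forall>c k i. \<rho> c k i \<in> adm c)"

lemma admissible_ins: "admissible \<rho> \<Longrightarrow> S \<in> adm c \<Longrightarrow> admissible (ins \<rho> c k d S)"
  by (auto simp: admissible_def ins_def)

text \<open>The trailing arguments in \<open>beta_closed\<close> carry the implication case:
  \<open>G\<close> is appended to them and the redex stays at the head.\<close>

lemma beta_closed_interp: "admissible \<rho> \<Longrightarrow> beta_closed (interp \<rho> A)"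
proof (induction A arbitrary: \<rho>)
  case Bot
  show ?case
    using bot_orth beta_closed_orth by (metis interp.simps(1) rangeE)
next
  case (Atom p ts)
  then show ?case
    by (cases p) (auto simp: beta_closed_def[of UNIV] admissible_def intro: beta_closed_adm)
next
  case (Imp A B)
  note B = Imp.IH(2)[OF Imp.prems]
  show ?case
    unfolding beta_closed_def
  proof (intro allI impI)
    fix u t ts
    assume *: "(\<lambda>i. apps (sub (case_nat (t i) Var) (u i)) (ts i)) \<in> interp \<rho> (A \<rightarrow>\<^sub>F B)"
    have "(\<lambda>i. App (apps (Lam (u i)) (t i # ts i)) (G i)) \<in> interp \<rho> B"
      if "G \<in> interp \<rho> A" for G
      using * that beta_closedD[OF B, of t u "\<lambda>i. ts i @ [G i]"] by (simp add: App_apps)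
    then show "(\<lambda>i. apps (Lam (u i)) (t i # ts i)) \<in> interp \<rho> (A \<rightarrow>\<^sub>F B)"
      by simp
  qed
next
  case (All2 c k A)
  then show ?case
    using admissible_ins[OF All2.prems] by (fastforce simp: beta_closed_def)
qed auto

text \<open>Orthogonality turns unions of stack sets into intersections.\<close>

lemma orth_Inter: "(\<And>S. S \<in> \<A> \<Longrightarrow> f S \<in> range orth) \<Longrightarrow> (\<Inter>S\<in>\<A>. f S) \<in> range orth"
proof -
  assume "\<And>S. S \<in> \<A> \<Longrightarrow> f S \<in> range orth"
  then have "\<forall>S\<in>\<A>. \<exists>\<Phi>. f S = orth \<Phi>"
    by blast
  then obtain g where "\<And>S. S \<in> \<A> \<Longrightarrow> f S = orth (g S)"
    using bchoice[of \<A> "\<lambda>S \<Phi>. f S = orth \<Phi>"] by blast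
  then have "(\<Inter>S\<in>\<A>. f S) = orth (\<Union>S\<in>\<A>. g S)"
    by (auto simp: orth_def)
  then show ?thesis
    by blast
qed

text \<open>Justifies the side condition of \<open>M2_allC_elim\<close>. An arrow prepends a
  realizer of its left side to each stack of its right side; a second-order quantifier is an
  intersection.\<close>

lemma classical_interp:
  "admissible \<rho> \<Longrightarrow> classical_type A \<Longrightarrow> interp \<rho> A \<in> adm Classical"
proof (induction A arbitrary: \<rho>)
  case Bot
  show ?case
    by (simp add: bot_orth)
next
  case (Atom p ts)
  then show ?case
    by (auto simp: classical_type_def admissible_def simp del: adm.simps)
next
  case (Imp A B)
  then have "interp \<rho> B \<in> adm Classical"
    by (simp add: classical_type_def)
  then obtain \<Phi> where \<Phi>: "interp \<rho> B = orth \<Phi>"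
    by auto
  have "interp \<rho> (A \<rightarrow>\<^sub>F B) = orth {\<lambda>i. G i # \<Pi> i | G \<Pi>. G \<in> interp \<rho> A \<and> \<Pi> \<in> \<Phi>}"
    by (fastforce simp: \<Phi> orth_def)
  then show ?case
    by simp
next
  case (All2 c k A)
  then have "interp (ins \<rho> c k 0 S) A \<in> range orth" if "S \<in> adm c" for S
    using admissible_ins[OF All2.prems(1) that] by (simp add: classical_type_def)
  then show ?case
    using orth_Inter[of "adm c" "\<lambda>S. interp (ins \<rho> c k 0 S) A"] by simp
qed (auto simp: classical_type_def)

text \<open>Against a stack \<Pi>, C hands \<open>F\<close> the term \<lambda>x. x\<Pi>. This
  realizes the negation, since applied to any \<open>H\<close> in the orthogonal it contracts to
  \<open>H\<close> against \<Pi>, which is in the pole.\<close>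

lemma C_interp_dne: "(\<lambda>i. ConstC) \<in> interp \<rho> dne"
proof -
  have "(\<lambda>i. App ConstC (F i)) \<in> orth \<Phi>"
    if F: "\<And>G. (\<And>H. H \<in> orth \<Phi> \<Longrightarrow> (\<lambda>i. App (G i) (H i)) \<in> bot) \<Longrightarrow> (\<lambda>i. App (F i) (G i)) \<in> bot"
    for \<Phi> F
  proof -
    have "(\<lambda>i. apps (App ConstC (F i)) (\<Pi> i)) \<in> bot" if "\<Pi> \<in> \<Phi>" for \<Pi>
    proof (rule expand)
      show "(\<lambda>i. App (F i) (Lam (apps (Var 0) (map (ren Suc) (\<Pi> i))))) \<in> bot"
      proof (rule F)
        fix H assume "H \<in> orth \<Phi>"
        with that have H: "(\<lambda>i. apps (H i) (\<Pi> i)) \<in> bot"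
          by (simp add: orth_def)
        have "sub s (apps t us) = apps (sub s t) (map (sub s) us)" for s t us
          by (induction us arbitrary: t) auto
        then have "head_step (App (Lam (apps (Var 0) (map (ren Suc) (\<Pi> i)))) (H i)) (apps (H i) (\<Pi> i))" for i
          using step_beta[of "apps (Var 0) (map (ren Suc) (\<Pi> i))" "H i" "[]"]
          by (simp add: comp_def sub_ren)
        with H show "(\<lambda>i. App (Lam (apps (Var 0) (map (ren Suc) (\<Pi> i)))) (H i)) \<in> bot"
          by (rule expand)
      qed
      show "head_step (apps (App ConstC (F i)) (\<Pi> i))
          (App (F i) (Lam (apps (Var 0) (map (ren Suc) (\<Pi> i)))))" for i
        using step_C[of "F i" "\<Pi> i"] by simp
    qed
    then show ?thesis
      by (simp add: orth_def)
  qed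
  then show ?thesis
    by (auto simp: dne_def ins_def)
qed

text \<open>Induction on the derivation. The substitution may vary with the index, while the term
  \<open>t\<close> and its derivation are common to all indices.\<close>

theorem adequacy:
  assumes "M2 L E \<Gamma> t A" "admissible \<rho>"
    and "\<And>j. j < length \<Gamma> \<Longrightarrow> (\<lambda>i. \<sigma> i j) \<in> interp \<rho> (\<Gamma> ! j)"
  shows "(\<lambda>i. sub (\<sigma> i) t) \<in> interp \<rho> A"
  using assms
proof (induction arbitrary: \<rho> \<sigma> rule: M2.induct)
  case (M2_imp_intro A \<Gamma> t B)
  have "(\<lambda>i. App (sub (\<sigma> i) (Lam t)) (G i)) \<in> interp \<rho> B" if G: "G \<in> interp \<rho> A" for G
  proof -
    have "(\<lambda>i. sub (case_nat (G i) (\<sigma> i)) t) \<in> interp \<rho> B"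
    proof (rule M2_imp_intro.IH[OF M2_imp_intro.prems(1)])
      show "(\<lambda>i. case_nat (G i) (\<sigma> i) j) \<in> interp \<rho> ((A # \<Gamma>) ! j)" if "j < length (A # \<Gamma>)" for j
        using that G M2_imp_intro.prems(2) by (cases j) auto
    qed
    then show ?thesis
      using beta_closedD[OF beta_closed_interp[OF M2_imp_intro.prems(1), of B],
          of G "\<lambda>i. sub (case_nat (Var 0) (\<lambda>j. ren Suc (\<sigma> i j))) t" "\<lambda>i. []"]
      by (simp add: sub_beta)
  qed
  then show ?case
    by simp
next
  case (M2_all2_intro k \<Gamma> t A)
  then show ?case
    by (simp add: interp_lift2 admissible_ins)
next
  case (M2_allC_intro k \<Gamma> t A)
  then show ?case
    by (simp add: interp_lift2 admissible_ins del: adm.simps)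
next
  case (M2_all2_elim \<Gamma> t k A G)
  then show ?case
    using beta_closed_interp[of \<rho> G] by (auto simp: interp_sub2)
next
  case (M2_allC_elim \<Gamma> t k A G)
  then show ?case
    using classical_interp[of \<rho> G] by (auto simp: interp_sub2 simp del: adm.simps)
next
  case M2_C
  show ?case
    using C_interp_dne by simp
next
  case (M2_imp_elim \<Gamma> t A B u)
  then show ?case
    by simp
next
  case (M2_all1_intro \<Gamma> t A)
  then show ?case
    by simp
next
  case (M2_eq \<Gamma> t u A v)
  then show ?case
    by simp
qed simp_all

end

section \<open>The game\<close>

inductive_set wins :: "('i \<Rightarrow> lcterm) \<Rightarrow> ('i \<Rightarrow> lcterm list) \<Rightarrow> ('i \<Rightarrow> nat) \<Rightarrow> ('i \<Rightarrow> lcterm) set"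
  for t ts b where
  wins_end: "(\<And>i. F i \<succ>\<^sub>C apps (Var (b i + l)) (ts i)) \<Longrightarrow> F \<in> wins t ts b"
| wins_round: "\<lbrakk>\<And>i. F i \<succ>\<^sub>C App (t i) (V i); \<And>l. (\<lambda>i. App (V i) (Var (b i + l))) \<in> wins t ts b\<rbrakk>
    \<Longrightarrow> F \<in> wins t ts b"

interpretation wins: pole "wins t ts b" for t ts b
proof
  fix F G :: "'a \<Rightarrow> lcterm"
  assume "G \<in> wins t ts b" and FG: "\<And>i. head_step (F i) (G i)"
  from this(1) show "F \<in> wins t ts b"
  proof cases
    case (wins_end l)
    show ?thesis
      by (rule wins.wins_end[where l = l])
        (rule converse_rtranclp_into_rtranclp[OF FG wins_end])
  next
    case (wins_round V)
    show ?thesis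
      by (rule wins.wins_round[where V = V])
        (rule converse_rtranclp_into_rtranclp[OF FG wins_round(1)], rule wins_round(2))
  qed
qed

lemma dne_wins:
  fixes L :: "('f, 'p) language"
  assumes "M2 L E [] T dne"
  shows "(\<lambda>i. apps T (t i # ts i)) \<in> wins t ts b"
proof -
  define S where "S = wins.orth t ts b {ts}"
  have y: "(\<lambda>i. Var (b i + l)) \<in> S" for l
    by (auto simp: S_def wins.orth_def intro: wins_end)
  have t: "(\<lambda>i. App (t i) (V i)) \<in> wins t ts b"
    if "\<And>H. H \<in> S \<Longrightarrow> (\<lambda>i. App (V i) (H i)) \<in> wins t ts b" for V
    by (rule wins_round[where V = V]) (auto intro: that[OF y])
  \<comment> \<open>\<open>dne\<close> is closed, so any admissible valuation will do;
    \<open>S\<close> is an orthogonal and hence also closed under expansion.\<close>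
  have "wins.admissible t ts b (\<lambda>_ _ _. S)"
    unfolding wins.admissible_def
  proof (intro allI)
    show "S \<in> wins.adm t ts b c" for c
      by (cases c) (auto simp: S_def wins.beta_closed_orth)
  qed
  from wins.adequacy[OF assms this, of "\<lambda>_. Var"]
  have "(\<lambda>i. T) \<in> wins.interp t ts b (\<lambda>_ _ _. S) (dne :: ('f, 'p) fml)"
    by simp
  moreover have "S \<in> wins.adm t ts b Classical"
    by (simp add: S_def)
  ultimately have "\<And>F. (\<And>V. (\<And>H. H \<in> S \<Longrightarrow> (\<lambda>i. App (V i) (H i)) \<in> wins t ts b)
      \<Longrightarrow> (\<lambda>i. App (F i) (V i)) \<in> wins t ts b) \<Longrightarrow> (\<lambda>i. App T (F i)) \<in> S"
    by (auto simp: dne_def ins_def simp del: wins.adm.simps)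
  from this[of t, OF t] show ?thesis
    by (simp add: S_def wins.orth_def)
qed

section \<open>From winning families to explicit sequences of moves\<close>

text \<open>The variables played so far are \<open>b, \<dots>, b + k - 1\<close>, and \<open>m\<close> rounds remain.\<close>

primrec play :: "lcterm \<Rightarrow> lcterm list \<Rightarrow> nat \<Rightarrow> nat \<Rightarrow> nat \<Rightarrow> lcterm \<Rightarrow> bool" where
  "play t ts b 0 k W \<longleftrightarrow> (\<exists>l<k. W \<succ>\<^sub>C apps (Var (b + l)) ts)"
| "play t ts b (Suc m) k W \<longleftrightarrow>
    (\<exists>V. W \<succ>\<^sub>C App t V \<and> play t ts b m (Suc k) (App V (Var (b + k))))"

lemma wins_play:
  assumes "F \<in> wins t ts b" "\<And>i. fv (F i) \<subseteq> {..<b i + k}"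
  shows "\<exists>m. \<forall>i. play (t i) (ts i) (b i) m k (F i)"
  using assms
proof (induction arbitrary: k rule: wins.induct)
  case (wins_end F l)
  have "l < k"
    using head_red_fv[OF wins_end.hyps] wins_end.prems by (fastforce simp: fv_apps)
  then have "\<forall>i. play (t i) (ts i) (b i) 0 k (F i)"
    using wins_end.hyps by auto
  then show ?case ..
next
  case (wins_round F V)
  have "fv (App (V i) (Var (b i + k))) \<subseteq> {..<b i + Suc k}" for i
    using head_red_fv[OF wins_round.hyps(1)[of i]] wins_round.prems[of i] by fastforce
  from wins_round.IH[OF this] obtain m
    where "\<And>i. play (t i) (ts i) (b i) m (Suc k) (App (V i) (Var (b i + k)))"
    by blast
  then have "\<forall>i. play (t i) (ts i) (b i) (Suc m) k (F i)"
    using wins_round.hyps(1) by auto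
  then show ?case ..
qed

text \<open>The term from which round \<open>j\<close> starts, counted from 0; \<open>b\<close> is
  the first variable to be played and \<open>V\<close> lists the replies.\<close>

definition position :: "nat \<Rightarrow> lcterm \<Rightarrow> (nat \<Rightarrow> lcterm) \<Rightarrow> nat \<Rightarrow> lcterm" where
  "position b W V = case_nat W (\<lambda>j. App (V j) (Var (b + j)))"

lemma position_simps [simp]:
  "position b W V 0 = W"
  "position b W V (Suc j) = App (V j) (Var (b + j))"
  by (simp_all add: position_def)

text \<open>Collects the nested existentials of \<open>play\<close> into one sequence; the bounds on
  free variables will give freshness.\<close>

lemma play_moves:
  assumes "play t ts b m k W" "fv W \<subseteq> {..<b + k}"
  shows "\<exists>V. (\<forall>j<m. fv (V j) \<subseteq> {..<b + k + j} \<and> position (b + k) W V j \<succ>\<^sub>C App t (V j)) \<and>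
    (\<exists>l<k + m. position (b + k) W V m \<succ>\<^sub>C apps (Var (b + l)) ts)"
  using assms
proof (induction m arbitrary: k W)
  case 0
  then show ?case
    by simp
next
  case (Suc m)
  then obtain U where U: "W \<succ>\<^sub>C App t U" "play t ts b m (Suc k) (App U (Var (b + k)))"
    by auto
  have fvU: "fv U \<subseteq> {..<b + k}"
    using head_red_fv[OF U(1)] Suc.prems(2) by auto
  then have "fv (App U (Var (b + k))) \<subseteq> {..<b + Suc k}"
    by auto
  from Suc.IH[OF U(2) this] obtain V where
    V: "\<forall>j<m. fv (V j) \<subseteq> {..<b + Suc k + j} \<and>
          position (b + Suc k) (App U (Var (b + k))) V j \<succ>\<^sub>C App t (V j)"
       "\<exists>l<Suc k + m. position (b + Suc k) (App U (Var (b + k))) V m \<succ>\<^sub>C apps (Var (b + l)) ts"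
    by blast
  \<comment> \<open>Prepending the first reply \<open>U\<close> delays the rest of the game by one
    round.\<close>
  have pos: "position (b + Suc k) (App U (Var (b + k))) V j
      = position (b + k) W (case_nat U V) (Suc j)" for j
    by (cases j) auto
  have "fv (case_nat U V j) \<subseteq> {..<b + k + j} \<and>
      position (b + k) W (case_nat U V) j \<succ>\<^sub>C App t (case_nat U V j)" if "j < Suc m" for j
  proof (cases j)
    case 0
    then show ?thesis
      using U(1) fvU by simp
  next
    case (Suc j')
    then show ?thesis
      using V(1) that unfolding pos by simp
  qed
  moreover have "\<exists>l<k + Suc m.
      position (b + k) W (case_nat U V) (Suc m) \<succ>\<^sub>C apps (Var (b + l)) ts"
    using V(2) unfolding pos by simp
  ultimately show ?case
    by blast
qed

theorem theorem7p2:
  fixes L :: "('f, 'p) language"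
    and E :: "('f trm \<times> 'f trm) set"
    and T :: lcterm
  assumes "\<forall>(a, b) \<in> E. wf_trm L a \<and> wf_trm L b"
    and "M2 L E [] T dne"
  shows "\<exists>m::nat. m \<ge> 1 \<and> (\<forall>n::nat. \<forall>t ts. length ts = n \<longrightarrow>
    (\<exists>(V :: nat \<Rightarrow> lcterm) (y :: nat \<Rightarrow> nat).
       inj_on y {1..m} \<and>
       (\<forall>j \<in> {1..m}. y j \<notin> fv T \<union> fv t \<union> \<Union> (fv ` set ts) \<and> (\<forall>i \<in> {1..j}. y j \<notin> fv (V i))) \<and>
       apps T (t # ts) \<succ>\<^sub>C App t (V 1) \<and>
       (\<forall>i. 1 \<le> i \<and> i \<le> m - 1 \<longrightarrow> App (V i) (Var (y i)) \<succ>\<^sub>C App t (V (i + 1))) \<and>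
       (\<exists>i \<in> {1..m}. App (V m) (Var (y m)) \<succ>\<^sub>C apps (Var (y i)) ts)))"
proof -
  \<comment> \<open>For each pair, \<open>b\<close> lies beyond all free variables;
    \<open>+ 0\<close> stands for no variable played yet.\<close>
  have "\<exists>b. fv (apps T (fst i # snd i)) \<subseteq> {..<b + 0}" for i
    using finite_fv[of "apps T (fst i # snd i)"] unfolding finite_nat_set_iff_bounded by auto
  then obtain b where b: "\<And>i. fv (apps T (fst i # snd i)) \<subseteq> {..<b i + 0}"
    by metis
  \<comment> \<open>The indices are all pairs \<open>(t, ts)\<close>, so a single family holds every
    instance and yields one \<open>m\<close>.\<close>
  from wins_play[OF dne_wins[OF assms(2), of fst snd b] b]
  obtain m where m: "\<And>i. play (fst i) (snd i) (b i) m 0 (apps T (fst i # snd i))"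
    by blast
  \<comment> \<open>With no rounds, \<open>play\<close> would ask for an offset below 0.\<close>
  have "m \<noteq> 0"
    using m[of "(T, [])"] by (cases m) auto
  have "\<exists>(V :: nat \<Rightarrow> lcterm) (y :: nat \<Rightarrow> nat).
       inj_on y {1..m} \<and>
       (\<forall>j \<in> {1..m}. y j \<notin> fv T \<union> fv t \<union> \<Union> (fv ` set ts) \<and> (\<forall>i \<in> {1..j}. y j \<notin> fv (V i))) \<and>
       apps T (t # ts) \<succ>\<^sub>C App t (V 1) \<and>
       (\<forall>i. 1 \<le> i \<and> i \<le> m - 1 \<longrightarrow> App (V i) (Var (y i)) \<succ>\<^sub>C App t (V (i + 1))) \<and>
       (\<exists>i \<in> {1..m}. App (V m) (Var (y m)) \<succ>\<^sub>C apps (Var (y i)) ts)" for t ts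
  proof -
    define c where "c = b (t, ts)"
    have fv: "fv T \<union> fv t \<union> \<Union> (fv ` set ts) \<subseteq> {..<c}"
      using b[of "(t, ts)"] by (auto simp: c_def fv_apps)
    obtain V l where V: "\<And>j. j < m \<Longrightarrow> fv (V j) \<subseteq> {..<c + j}"
        "\<And>j. j < m \<Longrightarrow> position c (apps T (t # ts)) V j \<succ>\<^sub>C App t (V j)"
      and l: "l < m" "position c (apps T (t # ts)) V m \<succ>\<^sub>C apps (Var (c + l)) ts"
      using play_moves[OF m b, of "(t, ts)"] by (auto simp: c_def)
    \<comment> \<open>The statement counts from 1 and the moves from 0, so the witnesses are
      \<open>V (i - 1)\<close> and \<open>c + (i - 1)\<close>.\<close>
    show ?thesis
    proof (intro exI conjI ballI allI impI)
      show "inj_on (\<lambda>j. c + (j - 1)) {1..m}"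
        by (auto simp: inj_on_def)
      show "c + (j - 1) \<notin> fv T \<union> fv t \<union> \<Union> (fv ` set ts)" for j
        using fv by (meson lessThan_iff not_add_less1 subsetD)
      show "c + (j - 1) \<notin> fv (V (i - 1))" if "j \<in> {1..m}" "i \<in> {1..j}" for i j
      proof -
        have "fv (V (i - 1)) \<subseteq> {..<c + (i - 1)}"
          using that by (intro V(1)) auto
        also have "\<dots> \<subseteq> {..c + (j - 1)} - {c + (j - 1)}"
          using that by auto
        finally show ?thesis
          by blast
      qed
      show "apps T (t # ts) \<succ>\<^sub>C App t (V (1 - 1))"
        using V(2)[of 0] \<open>m \<noteq> 0\<close> by simp
      show "App (V (i - 1)) (Var (c + (i - 1))) \<succ>\<^sub>C App t (V (i + 1 - 1))"
        if "1 \<le> i \<and> i \<le> m - 1" for i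
        using V(2)[of i] that by (cases i) auto
      show "\<exists>i\<in>{1..m}. App (V (m - 1)) (Var (c + (m - 1))) \<succ>\<^sub>C apps (Var (c + (i - 1))) ts"
        using l \<open>m \<noteq> 0\<close> by (intro bexI[of _ "Suc l"]; cases m) auto
    qed
  qed
  then show ?thesis
    using \<open>m \<noteq> 0\<close> by (intro exI[of _ m]) auto
qed

end
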